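(* Let $K$ be a commutative ring with unit, $\lambda\in K$, $X$ a well-ordered set, and $\Omega=\{P\}$ with $P$ a unary operator symbol. With respect to the order $>$ on $\mathcal{Q}(X)$ defined in the context, the set $$S=\{P(u)P(v)-P(P(u)v)-P(uP(v))-\lambda P(uv)\mid u,v\in\mathcal{Q}(X)\}$$ is a Gröbner-Shirshov basis in $K[X;P]$.
   Context: Algebras are associative and not necessarily unital. For a set $Y$, $CS(Y)$ is the free commutative semigroup on $Y$ (nonempty commutative words). Put $\mathcal{Q}_0=CS(X)$, $\Gamma_n=X\cup\{P(u)\mid u\in\mathcal{Q}_{n-1}\}$ (formal expressions) and $\mathcal{Q}_n=CS(\Gamma_n)$ for $n\ge1$, and $\mathcal{Q}(X)=\bigcup_{n\ge0}\mathcal{Q}_n$. Each $u\in\mathcal{Q}(X)$ is uniquely (up to order of factors) a product $u_1\cdots u_n$ with $n\ge1$ and $u_i\in X\cup P(\mathcal{Q}(X))$; put $bre(u)=n$. $K[X;P]$ is the commutative $K$-algebra with $K$-basis $\mathcal{Q}(X)$, with $P$ extended $K$-linearly. $\mathcal{Q}^\star(X)$ is the set of elements of $\mathcal{Q}(X\cup\{\star\})$, $\star\notin X$, in which $\star$ occurs exactly once. For $u\in\mathcal{Q}^\star(X)$ and $s\in K[X;P]$, $u|_s$ is obtained by replacing $\star$ by $s$ in $u$. The order $>$ on $\mathcal{Q}(X)$ is defined recursively (by induction on $n$ for $\mathcal{Q}_n$). On $X\cup P(\mathcal{Q}(X))$: elements of $X$ are compared by the given order of $X$; every $P(u')$ is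 greater than every element of $X$; $P(u')>P(v')$ iff $u'>v'$. For $u,v\in\mathcal{Q}(X)$ write $u=w_1^{i_1}\cdots w_t^{i_t}$, $v=w_1^{j_1}\cdots w_t^{j_t}$ with $w_1>w_2>\cdots>w_t$ in $X\cup P(\mathcal{Q}(X))$ and exponents $i_k,j_k\ge0$; then $u>v$ iff $(bre(u),i_1,\dots,i_t)>(bre(v),j_1,\dots,j_t)$ lexicographically. For nonzero $f\in K[X;P]$, $\bar f$ is the largest element of $\mathcal{Q}(X)$ occurring in $f$ with nonzero coefficient; $f$ is monic if the coefficient of $\bar f$ is $1$. Compositions of monic $f,g$: (i) if $w=a\bar f=b\bar g$ for some $a,b\in\mathcal{Q}(X)$ with $bre(w)<bre(\bar f)+bre(\bar g)$, then $(f,g)_w=af-bg$; (ii) if $w=\bar f=u|_{\bar g}$ for some $u\in\mathcal{Q}^\star(X)$, then $(f,g)_w=f-u|_g$. For a set $S$ of monic elements, $(f,g)_w$ is trivial modulo $(S,w)$ if $(f,g)_w=\sum_i\alpha_iu_i|_{s_i}$ (finite sum) with $\alpha_i\in K$, $u_i\in\mathcal{Q}^\star(X)$, $s_i\in S$ and $u_i|_{\overline{s_i}}<w$ for all $i$. $S$ is a Gröbner-Shirshov basis in $K[X;P]$ (with respect to $>$) if every composition $(f,g)_w$ with $f,g\in S$ is trivial modulo $(S,w)$. *)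

theory Defs
  imports "HOL-Library.Multiset" "HOL-Library.Poly_Mapping"
begin

text \<open>
  A commutative word is the multiset of its factors, so concatenation is \<open>+\<close> on multisets and
  the breadth of a word is its \<open>size\<close>.  The type also contains the empty word (even nested
  under the operator); the words of the paper are carved out by \<open>Q\<close> below.
\<close>

datatype 'x factor = Var 'x | Op "'x factor multiset"

type_synonym 'x word = "'x factor multiset"

definition CS :: "'a set \<Rightarrow> 'a multiset set" where
  "CS Y = {u. u \<noteq> {#} \<and> set_mset u \<subseteq> Y}"

primrec Qn :: "'x set \<Rightarrow> nat \<Rightarrow> 'x word set" where
  "Qn X 0 = CS (Var ` X)"
| "Qn X (Suc n) = CS (Var ` X \<union> Op ` Qn X n)"

definition Q :: "'x set \<Rightarrow> 'x word set" where
  "Q X = (\<Union>n. Qn X n)"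


text \<open>
  The type \<open>'x word \<Rightarrow>\<^sub>0 'k\<close> is the monoid algebra on all words; its unit is the empty word.
  \<open>K[X;P]\<close> is the non-unital subalgebra spanned by \<open>Q X\<close>.
\<close>

definition KXP :: "'x set \<Rightarrow> ('x word \<Rightarrow>\<^sub>0 'k::comm_ring_1) set" where
  "KXP X = {f. Poly_Mapping.keys f \<subseteq> Q X}"

definition mon :: "'x word \<Rightarrow> ('x word \<Rightarrow>\<^sub>0 'k::comm_ring_1)" where
  "mon u = Poly_Mapping.single u 1"

definition scale :: "'k::comm_ring_1 \<Rightarrow> ('x word \<Rightarrow>\<^sub>0 'k) \<Rightarrow> ('x word \<Rightarrow>\<^sub>0 'k)" where
  "scale c f = Poly_Mapping.map ((*) c) f"

definition P :: "('x word \<Rightarrow>\<^sub>0 'k::comm_ring_1) \<Rightarrow> ('x word \<Rightarrow>\<^sub>0 'k)" where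
  "P f = (\<Sum>u\<in>Poly_Mapping.keys f. scale (Poly_Mapping.lookup f u) (mon {#Op u#}))"


text \<open>The symbol \<open>\<star>\<close> is \<open>None\<close>, and \<open>x \<in> X\<close> becomes \<open>Some x\<close>.\<close>

primrec stars_factor :: "'x option factor \<Rightarrow> nat" where
  "stars_factor (Var y) = (if y = None then 1 else 0)"
| "stars_factor (Op u) = sum_mset (image_mset stars_factor u)"

definition stars :: "'x option word \<Rightarrow> nat" where
  "stars u = sum_mset (image_mset stars_factor u)"

definition Qstar :: "'x set \<Rightarrow> 'x option word set" where
  "Qstar X = {u \<in> Q (insert None (Some ` X)). stars u = 1}"

primrec subst_factor :: "('x word \<Rightarrow>\<^sub>0 'k::comm_ring_1) \<Rightarrow> 'x option factor \<Rightarrow> ('x word \<Rightarrow>\<^sub>0 'k)" where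
  "subst_factor s (Var y) = (case y of None \<Rightarrow> s | Some x \<Rightarrow> mon {#Var x#})"
| "subst_factor s (Op u) = P (prod_mset (image_mset (subst_factor s) u))"

definition subst :: "'x option word \<Rightarrow> ('x word \<Rightarrow>\<^sub>0 'k::comm_ring_1) \<Rightarrow> ('x word \<Rightarrow>\<^sub>0 'k)" where
  "subst u s = prod_mset (image_mset (subst_factor s) u)"

text \<open>
  The same replacement for a word \<open>v\<close> in place of \<open>\<star>\<close>, with the result as a word;
  \<open>subst_mon\<close> shows that it agrees with \<open>subst\<close>.
\<close>

primrec subst_word_factor :: "'x word \<Rightarrow> 'x option factor \<Rightarrow> 'x word" where
  "subst_word_factor v (Var y) = (case y of None \<Rightarrow> v | Some x \<Rightarrow> {#Var x#})"
| "subst_word_factor v (Op u) = {#Op (sum_mset (image_mset (subst_word_factor v) u))#}"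

definition subst_word :: "'x option word \<Rightarrow> 'x word \<Rightarrow> 'x word" where
  "subst_word u v = sum_mset (image_mset (subst_word_factor v) u)"

lemma P_mon: "P (mon u :: 'x word \<Rightarrow>\<^sub>0 'k::comm_ring_1) = mon {#Op u#}"
proof -
  have "scale (1::'k) f = f" for f :: "'x word \<Rightarrow>\<^sub>0 'k"
    unfolding scale_def
    by (rule poly_mapping_eqI) (simp add: Poly_Mapping.map.rep_eq when_def)
  then show ?thesis
    by (simp add: P_def) (simp add: mon_def)
qed

lemma prod_mset_mon: "prod_mset (image_mset (\<lambda>a. mon (h a)) u) = mon (sum_mset (image_mset h u))"
  by (induction u) (simp_all add: mon_def Poly_Mapping.mult_single)

lemma subst_factor_mon:
  "subst_factor (mon v) a = (mon (subst_word_factor v a) :: 'x word \<Rightarrow>\<^sub>0 'k::comm_ring_1)"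
proof (induction a)
  case (Var y)
  then show ?case by (simp split: option.split)
next
  case (Op u)
  have "image_mset (subst_factor (mon v :: 'x word \<Rightarrow>\<^sub>0 'k)) u
      = image_mset (\<lambda>a. mon (subst_word_factor v a)) u"
    by (rule image_mset_cong) (rule Op)
  then show ?case by (simp add: prod_mset_mon P_mon)
qed

lemma subst_mon: "subst u (mon v) = mon (subst_word u v)"
  unfolding subst_def subst_word_def prod_mset_mon[symmetric]
  by (simp only: subst_factor_mon[symmetric])


lemma sorted_wrt_mono_inductive [mono]:
  "(\<And>x y. R x y \<longrightarrow> R' x y) \<Longrightarrow> sorted_wrt R xs \<longrightarrow> sorted_wrt R' xs"
  by (metis sorted_wrt_mono_rel)

text \<open>
  In the last rule \<open>ws = [w\<^sub>1, \<dots>, w\<^sub>t]\<close> with \<open>w\<^sub>1 > \<dots> > w\<^sub>t\<close> lists the factors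
  occurring in \<open>u\<close> or \<open>v\<close>; further factors would have exponent \<open>0\<close> in both words
  and do not affect the comparison.  \<open>lex\<close> relates the smaller tuple to the larger one.
\<close>

inductive factor_gt :: "'x::linorder factor \<Rightarrow> 'x factor \<Rightarrow> bool"
  and word_gt :: "'x::linorder word \<Rightarrow> 'x word \<Rightarrow> bool"
where
  Var_Var: "x > y \<Longrightarrow> factor_gt (Var x) (Var y)"
| Op_Var: "factor_gt (Op u) (Var x)"
| Op_Op: "word_gt u v \<Longrightarrow> factor_gt (Op u) (Op v)"
| word: "\<lbrakk> sorted_wrt factor_gt ws; set ws = set_mset u \<union> set_mset v;
           (size v # map (count v) ws, size u # map (count u) ws) \<in> lex less_than \<rbrakk>
         \<Longrightarrow> word_gt u v"


definition lead :: "('x::linorder word \<Rightarrow>\<^sub>0 'k::comm_ring_1) \<Rightarrow> 'x word" where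
  "lead f = (THE u. u \<in> Poly_Mapping.keys f \<and> (\<forall>v\<in>Poly_Mapping.keys f. v \<noteq> u \<longrightarrow> word_gt u v))"

definition monic :: "('x::linorder word \<Rightarrow>\<^sub>0 'k::comm_ring_1) \<Rightarrow> bool" where
  "monic f \<longleftrightarrow> f \<noteq> 0 \<and> Poly_Mapping.lookup f (lead f) = 1"

text \<open>\<open>composition X f g w h\<close> says that \<open>h\<close> is a composition \<open>(f,g)\<^sub>w\<close>.\<close>

inductive composition ::
  "'x::linorder set \<Rightarrow> ('x word \<Rightarrow>\<^sub>0 'k::comm_ring_1) \<Rightarrow> ('x word \<Rightarrow>\<^sub>0 'k) \<Rightarrow> 'x word \<Rightarrow> ('x word \<Rightarrow>\<^sub>0 'k) \<Rightarrow> bool"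
  for X f g w
where
  intersection: "\<lbrakk> a \<in> Q X; b \<in> Q X; w = a + lead f; w = b + lead g;
                   size w < size (lead f) + size (lead g) \<rbrakk>
                 \<Longrightarrow> composition X f g w (mon a * f - mon b * g)"
| inclusion: "\<lbrakk> u \<in> Qstar X; w = lead f; w = subst_word u (lead g) \<rbrakk>
              \<Longrightarrow> composition X f g w (f - subst u g)"

definition trivial_mod ::
  "'x::linorder set \<Rightarrow> ('x word \<Rightarrow>\<^sub>0 'k::comm_ring_1) set \<Rightarrow> 'x word \<Rightarrow> ('x word \<Rightarrow>\<^sub>0 'k) \<Rightarrow> bool" where
  "trivial_mod X S w h \<longleftrightarrow>
     (\<exists>(n::nat) \<alpha> u s.
        (\<forall>i<n. u i \<in> Qstar X \<and> s i \<in> S \<and> word_gt w (subst_word (u i) (lead (s i)))) \<and>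
        h = (\<Sum>i<n. scale (\<alpha> i) (subst (u i) (s i))))"

definition groebner_shirshov_basis ::
  "'x::linorder set \<Rightarrow> ('x word \<Rightarrow>\<^sub>0 'k::comm_ring_1) set \<Rightarrow> bool" where
  "groebner_shirshov_basis X S \<longleftrightarrow>
     S \<subseteq> KXP X \<and> (\<forall>f\<in>S. monic f) \<and>
     (\<forall>f\<in>S. \<forall>g\<in>S. \<forall>w h. composition X f g w h \<longrightarrow> trivial_mod X S w h)"

definition rota_baxter_relations ::
  "'x set \<Rightarrow> 'k::comm_ring_1 \<Rightarrow> ('x word \<Rightarrow>\<^sub>0 'k) set" where
  "rota_baxter_relations X c =
     {P (mon u) * P (mon v) - P (P (mon u) * mon v) - P (mon u * P (mon v))
        - scale c (P (mon u * mon v)) | u v. u \<in> Q X \<and> v \<in> Q X}"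

end

theory Submission
  imports Defs
begin

text \<open>
  Put \<open>A(f, g) = P(f) g + f P(g) + c f g\<close> and \<open>F(f, g) = P(f) P(g) - P(A(f, g))\<close>; both are bilinear and
  symmetric, and the relations are the \<open>F(u, v)\<close> for words \<open>u\<close>, \<open>v\<close>, with leading word
  \<open>P(u) P(v)\<close> of breadth \<open>2\<close> and all other words of breadth \<open>1\<close>.

  Proper intersections have \<open>w = P(x) P(y) P(z)\<close>, and there
  \<open>P(z) F(x, y) - P(x) F(y, z) = F(x, A(y, z)) - F(z, A(x, y)) + P(z F(x, y)) - P(x F(y, z))\<close>,
  where every leading word on the right has breadth at most \<open>2\<close>.

  Proper inclusions have \<open>w = P(b) P(v)\<close>, where \<open>b\<close> is a star word \<open>q\<close> with the leading word of a
  relation \<open>g\<close> substituted.  With \<open>h\<close> the result of substituting \<open>g\<close> itself into \<open>q\<close>,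
  \<open>F(b, v) - P(h) P(v) = F(b - h, v) - P(A(h, v))\<close>.  The words of \<open>b - h\<close> are smaller than \<open>b\<close>,
  and \<open>P(A(h, v))\<close> is a combination of star words applied to \<open>g\<close> with leading words of breadth \<open>1\<close>.
\<close>

subsection \<open>The order on words\<close>

text \<open>The carrier set is explicit because linearity of \<open>factor_gt\<close> is obtained
  first on factors of bounded nesting depth.\<close>

definition strict_linear_on :: "'a set \<Rightarrow> ('a \<Rightarrow> 'a \<Rightarrow> bool) \<Rightarrow> bool" where
  "strict_linear_on A R \<longleftrightarrow> irreflp_on A R \<and> transp_on A R \<and> totalp_on A R"

lemma strict_linear_on_irrefl: "strict_linear_on A R \<Longrightarrow> a \<in> A \<Longrightarrow> \<not> R a a"
  by (auto simp: strict_linear_on_def irreflp_on_def)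

lemma strict_linear_on_trans:
  "strict_linear_on A R \<Longrightarrow> R a b \<Longrightarrow> R b d \<Longrightarrow> a \<in> A \<Longrightarrow> b \<in> A \<Longrightarrow> d \<in> A \<Longrightarrow> R a d"
  unfolding strict_linear_on_def by (meson transp_onD)

lemma strict_linear_on_total:
  "strict_linear_on A R \<Longrightarrow> a \<in> A \<Longrightarrow> b \<in> A \<Longrightarrow> a \<noteq> b \<Longrightarrow> R a b \<or> R b a"
  by (auto simp: strict_linear_on_def totalp_on_def)

lemma strict_linear_on_asym:
  "strict_linear_on A R \<Longrightarrow> R a b \<Longrightarrow> a \<in> A \<Longrightarrow> b \<in> A \<Longrightarrow> \<not> R b a"
  by (meson strict_linear_on_irrefl strict_linear_on_trans)

lemma strict_linear_on_subset:
  "strict_linear_on A R \<Longrightarrow> B \<subseteq> A \<Longrightarrow> strict_linear_on B R"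
  unfolding strict_linear_on_def
  using irreflp_on_subset transp_on_subset totalp_on_subset by metis

text \<open>Totality and transitivity allow the sorted list to be split into the elements above and
  below \<open>x\<close>. This supplies the list \<open>ws\<close> that the rule \<open>word\<close>
  requires.\<close>

lemma ex_sorted_wrt:
  assumes "finite B" "strict_linear_on B R"
  shows "\<exists>ws. set ws = B \<and> sorted_wrt R ws"
  using assms
proof (induction B)
  case (insert x B)
  have sl: "strict_linear_on B R"
    using insert.prems by (rule strict_linear_on_subset) blast
  from insert.IH[OF sl] obtain ws where ws: "set ws = B" "sorted_wrt R ws"
    by blast
  let ?ws = "filter (\<lambda>y. R y x) ws @ x # filter (R x) ws"
  have "set ?ws = insert x B"
    using ws(1) strict_linear_on_total[OF insert.prems, of x] insert.hyps by auto
  moreover have "sorted_wrt R ?ws"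
    using ws strict_linear_on_trans[OF insert.prems, of _ x]
    by (auto simp: sorted_wrt_append sorted_wrt_filter)
  ultimately show ?case by blast
qed auto

lemma ex_maximal:
  assumes "finite B" "B \<noteq> {}" "strict_linear_on B R"
  shows "\<exists>a\<in>B. \<forall>b\<in>B. \<not> R b a"
proof -
  obtain ws where ws: "set ws = B" "sorted_wrt R ws"
    using ex_sorted_wrt[OF assms(1,3)] by blast
  then obtain a bs where "ws = a # bs"
    using assms(2) by (cases ws) auto
  then have "a \<in> B" "\<forall>b\<in>B. b = a \<or> R a b"
    using ws by auto
  then show ?thesis
    using strict_linear_on_asym[OF assms(3)] strict_linear_on_irrefl[OF assms(3)] by metis
qed

text \<open>The comparison of exponent tuples in \<open>word_gt\<close>, without the list of factors.\<close>

definition multiset_gt :: "('a \<Rightarrow> 'a \<Rightarrow> bool) \<Rightarrow> 'a multiset \<Rightarrow> 'a multiset \<Rightarrow> bool" where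
  "multiset_gt R u v \<longleftrightarrow> size v < size u \<or>
     size v = size u \<and>
     (\<exists>a. count v a < count u a \<and> (\<forall>b. b \<in># u + v \<longrightarrow> R b a \<longrightarrow> count v b = count u b))"

text \<open>For totality, the greatest factor with differing multiplicities decides. For
  transitivity, the greater of the two deciding factors decides the composed comparison.\<close>

lemma strict_linear_on_multiset_gt:
  assumes R: "strict_linear_on A R"
  shows "strict_linear_on {u. set_mset u \<subseteq> A} (multiset_gt R)"
  unfolding strict_linear_on_def
proof (intro conjI)
  show "irreflp_on {u. set_mset u \<subseteq> A} (multiset_gt R)"
    by (rule irreflp_onI) (simp add: multiset_gt_def)
  show "totalp_on {u. set_mset u \<subseteq> A} (multiset_gt R)"
  proof (rule totalp_onI)
    fix u v assume uv: "u \<in> {u. set_mset u \<subseteq> A}" "v \<in> {u. set_mset u \<subseteq> A}" "u \<noteq> v"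
    let ?B = "{a \<in> set_mset (u + v). count u a \<noteq> count v a}"
    obtain a0 where a0: "count u a0 \<noteq> count v a0"
      using uv(3) by (auto simp: multiset_eq_iff)
    then have "a0 \<in># u + v"
      by (metis count_union add_eq_0_iff_both_eq_0 not_in_iff)
    then have "?B \<noteq> {}"
      using a0 by blast
    moreover have "strict_linear_on ?B R"
      using uv by (intro strict_linear_on_subset[OF R]) auto
    ultimately obtain a where "a \<in> ?B" "\<forall>b\<in>?B. \<not> R b a"
      using ex_maximal[of ?B R] by auto
    then have "count v a < count u a \<or> count u a < count v a"
      "b \<in># u + v \<Longrightarrow> R b a \<Longrightarrow> count u b = count v b" for b
      by auto
    then show "multiset_gt R u v \<or> multiset_gt R v u"
      unfolding multiset_gt_def union_commute[of v u] by (metis linorder_neqE_nat)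
  qed
  show "transp_on {u. set_mset u \<subseteq> A} (multiset_gt R)"
  proof (rule transp_onI)
    fix u v w
    assume in_A: "u \<in> {u. set_mset u \<subseteq> A}" "v \<in> {u. set_mset u \<subseteq> A}" "w \<in> {u. set_mset u \<subseteq> A}"
      and uv: "multiset_gt R u v" and vw: "multiset_gt R v w"
    show "multiset_gt R u w"
    proof (cases "size w < size u")
      case True
      then show ?thesis by (simp add: multiset_gt_def)
    next
      case False
      then have sz: "size v = size u" "size w = size v"
        using uv vw by (auto simp: multiset_gt_def)
      have zero: "count y b = 0" if "b \<notin># y" for b :: 'a and y
        using that by (simp add: not_in_iff)
      obtain a where a: "count v a < count u a"
        "\<And>b. b \<in># u + v \<Longrightarrow> R b a \<Longrightarrow> count v b = count u b"
        using uv sz by (auto simp: multiset_gt_def)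
      have a': "count v b = count u b" if "R b a" for b
        using a(2)[of b] that zero[of b u] zero[of b v] by fastforce
      obtain d where d: "count w d < count v d"
        "\<And>b. b \<in># v + w \<Longrightarrow> R b d \<Longrightarrow> count w b = count v b"
        using vw sz by (auto simp: multiset_gt_def)
      have d': "count w b = count v b" if "R b d" for b
        using d(2)[of b] that zero[of b v] zero[of b w] by fastforce
      have ad: "a \<in> A" "d \<in> A"
        using in_A a(1) d(1) zero[of a u] zero[of d v] by force+
      consider "a = d" | "R a d" | "R d a"
        using strict_linear_on_total[OF R ad] by blast
      then have "\<exists>e. count w e < count u e \<and> (\<forall>b. b \<in># u + w \<longrightarrow> R b e \<longrightarrow> count w b = count u b)"
      proof cases
        case 1
        then show ?thesis
          using a(1) d(1) a' d' by (intro exI[of _ a]) auto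
      next
        case 2
        have "R b d" if "b \<in># u + w" "R b a" for b
          using that in_A by (auto intro: strict_linear_on_trans[OF R _ 2 _ ad])
        then show ?thesis
          using a(1) a' d' d'[OF 2] by (intro exI[of _ a]) auto
      next
        case 3
        have "R b a" if "b \<in># u + w" "R b d" for b
          using that in_A by (auto intro: strict_linear_on_trans[OF R _ 3 _ ad(2,1)])
        then show ?thesis
          using d(1) a' d' a'[OF 3] by (intro exI[of _ d]) auto
      qed
      then show ?thesis
        using sz by (simp add: multiset_gt_def)
    qed
  qed
qed

lemma map_lex_less_than_iff:
  "(map f ws, map g ws) \<in> lex less_than \<longleftrightarrow>
     (\<exists>as a bs. ws = as @ a # bs \<and> f a < g a \<and> (\<forall>b\<in>set as. f b = g b))"
  for f g :: "'a \<Rightarrow> nat"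
proof (induction ws)
  case (Cons w ws)
  show ?case (is "_ \<longleftrightarrow> ?R")
  proof
    assume "(map f (w # ws), map g (w # ws)) \<in> lex less_than"
    then consider "f w < g w" | "f w = g w" "(map f ws, map g ws) \<in> lex less_than"
      by auto
    then show ?R
    proof cases
      case 1
      then show ?thesis by (intro exI[of _ "[]"]) auto
    next
      case 2
      then obtain as a bs where "ws = as @ a # bs" "f a < g a" "\<forall>b\<in>set as. f b = g b"
        using Cons.IH by blast
      then show ?thesis
        using 2(1) by (intro exI[of _ "w # as"]) auto
    qed
  next
    assume ?R
    then obtain as a bs where *: "w # ws = as @ a # bs" "f a < g a" "\<forall>b\<in>set as. f b = g b"
      by blast
    then show "(map f (w # ws), map g (w # ws)) \<in> lex less_than"
      using Cons.IH by (cases as) auto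
  qed
qed simp

text \<open>A sorted \<open>ws\<close> lists before \<open>a\<close> exactly the factors greater
  than \<open>a\<close>, so the lexicographic condition does not depend on which sorted list is
  chosen.\<close>

lemma word_gt_iff_multiset_gt:
  assumes R: "strict_linear_on (set_mset (u + v)) factor_gt"
  shows "word_gt u v \<longleftrightarrow> multiset_gt factor_gt u v"
proof -
  have main: "((size v # map (count v) ws, size u # map (count u) ws) \<in> lex less_than)
      \<longleftrightarrow> multiset_gt factor_gt u v"
    if ws: "sorted_wrt factor_gt ws" "set ws = set_mset u \<union> set_mset v" for ws
  proof -
    have before: "b \<in> set as \<longleftrightarrow> b \<in># u + v \<and> factor_gt b a" if "ws = as @ a # bs" for as a bs b
    proof -
      have s: "set ws = set_mset (u + v)" using ws(2) by simp
      have "factor_gt b a" if "b \<in> set as"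
        using ws(1) that \<open>ws = _\<close> by (simp add: sorted_wrt_append)
      moreover have "\<not> factor_gt b a" if "b = a \<or> b \<in> set bs"
        using ws(1) that \<open>ws = _\<close> s
          strict_linear_on_irrefl[OF R, of a] strict_linear_on_asym[OF R, of a b]
        by (auto simp: sorted_wrt_append)
      ultimately show ?thesis
        using s \<open>ws = _\<close> by (metis Un_iff set_append set_ConsD list.set_intros)
    qed
    have "(\<exists>as a bs. ws = as @ a # bs \<and> count v a < count u a \<and> (\<forall>b\<in>set as. count v b = count u b))
      \<longleftrightarrow> (\<exists>a. count v a < count u a \<and>
            (\<forall>b. b \<in># u + v \<longrightarrow> factor_gt b a \<longrightarrow> count v b = count u b))" (is "?L \<longleftrightarrow> ?R")
    proof
      assume ?L
      then show ?R using before by metis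
    next
      assume ?R
      then obtain a where a: "count v a < count u a"
        "\<forall>b. b \<in># u + v \<longrightarrow> factor_gt b a \<longrightarrow> count v b = count u b" by blast
      have "a \<in># u" using a(1) by (metis not_in_iff not_less0)
      then have "a \<in> set ws" using ws(2) by simp
      then obtain as bs where "ws = as @ a # bs" by (meson split_list)
      then show ?L using a before by blast
    qed
    then show ?thesis
      by (simp add: map_lex_less_than_iff multiset_gt_def)
  qed
  have "\<exists>ws. sorted_wrt factor_gt ws \<and> set ws = set_mset u \<union> set_mset v"
    using ex_sorted_wrt[OF _ R] by auto
  then show ?thesis
    using main by (auto simp: word_gt.simps)
qed

text \<open>
  Comparing words presupposes that their factors are linearly ordered, so linearity of
  \<open>factor_gt\<close> is proved by induction on the nesting depth.
\<close>

primrec factors_upto :: "nat \<Rightarrow> 'x factor set" where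
  "factors_upto 0 = {}"
| "factors_upto (Suc n) = range Var \<union> Op ` {u. set_mset u \<subseteq> factors_upto n}"

lemma factors_upto_Suc: "factors_upto n \<subseteq> factors_upto (Suc n)"
  by (induction n) auto

lemma factors_upto_mono: "m \<le> n \<Longrightarrow> factors_upto m \<subseteq> factors_upto n"
  by (rule lift_Suc_mono_le[of factors_upto]) (rule factors_upto_Suc)

lemma finite_subset_factors_upto:
  assumes "finite B" "\<And>a. a \<in> B \<Longrightarrow> \<exists>n. a \<in> factors_upto n"
  shows "\<exists>n. B \<subseteq> factors_upto n"
  using assms
proof (induction B)
  case (insert a B)
  then obtain m n where "B \<subseteq> factors_upto m" "a \<in> factors_upto n"
    by blast
  then have "insert a B \<subseteq> factors_upto (max m n)"
    using factors_upto_mono[of m "max m n"] factors_upto_mono[of n "max m n"] by auto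
  then show ?case by blast
qed simp

lemma ex_factors_upto: "\<exists>n. a \<in> factors_upto n"
proof (induction a)
  case (Var x)
  show ?case by (intro exI[of _ 1]) simp
next
  case (Op u)
  obtain n where "set_mset u \<subseteq> factors_upto n"
    using finite_subset_factors_upto[of "set_mset u"] Op by auto
  then show ?case by (intro exI[of _ "Suc n"]) simp
qed

text \<open>On words over level \<open>n\<close>, \<open>word_gt\<close> coincides with the linear
  order \<open>multiset_gt\<close>. Level \<open>Suc n\<close> then has the variables below the
  operator factors, which are compared by their arguments.\<close>

lemma strict_linear_on_factor_gt_upto:
  "strict_linear_on (factors_upto n :: 'x::linorder factor set) factor_gt"
proof (induction n)
  case 0
  show ?case by (simp add: strict_linear_on_def irreflp_on_def transp_on_def)
next
  case (Suc n)
  let ?W = "{u. set_mset u \<subseteq> factors_upto n} :: 'x word set"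
  have W: "strict_linear_on ?W (multiset_gt factor_gt)"
    by (rule strict_linear_on_multiset_gt[OF Suc])
  have word: "word_gt u v \<longleftrightarrow> multiset_gt factor_gt u v" if "u \<in> ?W" "v \<in> ?W" for u v
    by (rule word_gt_iff_multiset_gt) (use that in \<open>auto intro: strict_linear_on_subset[OF Suc]\<close>)
  have simps: "factor_gt (Var x) (Var y) \<longleftrightarrow> y < x" "\<not> factor_gt (Var x) (Op u)" "factor_gt (Op u) (Var x)"
    "factor_gt (Op u) (Op v) \<longleftrightarrow> word_gt u v" for x y :: 'x and u v
    by (simp_all add: factor_gt.simps)
  show ?case
    unfolding strict_linear_on_def
  proof (intro conjI)
    show "irreflp_on (factors_upto (Suc n) :: 'x factor set) factor_gt"
      using strict_linear_on_irrefl[OF W] by (auto intro!: irreflp_onI simp: simps word)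
    show "totalp_on (factors_upto (Suc n) :: 'x factor set) factor_gt"
    proof (rule totalp_onI)
      fix a b :: "'x factor"
      assume *: "a \<in> factors_upto (Suc n)" "b \<in> factors_upto (Suc n)" "a \<noteq> b"
      show "factor_gt a b \<or> factor_gt b a"
      proof (cases "\<exists>u v. a = Op u \<and> b = Op v")
        case True
        then obtain u v where "a = Op u" "b = Op v" by blast
        then show ?thesis
          using * strict_linear_on_total[OF W, of u v] word[of u v] word[of v u]
          by (auto simp: simps)
      next
        case False
        then show ?thesis
          using * by (cases a; cases b) (auto simp: simps)
      qed
    qed
    show "transp_on (factors_upto (Suc n) :: 'x factor set) factor_gt"
    proof (rule transp_onI)
      fix a b d :: "'x factor"
      assume *: "a \<in> factors_upto (Suc n)" "b \<in> factors_upto (Suc n)" "d \<in> factors_upto (Suc n)"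
        "factor_gt a b" "factor_gt b d"
      show "factor_gt a d"
      proof (cases "\<exists>u v w. a = Op u \<and> b = Op v \<and> d = Op w")
        case True
        then obtain u v w where "a = Op u" "b = Op v" "d = Op w" by blast
        then show ?thesis
          using * strict_linear_on_trans[OF W, of u v w] word[of u v] word[of v w] word[of u w]
          by (auto simp: simps)
      next
        case False
        then show ?thesis
          using * by (cases a; cases b; cases d) (auto simp: simps)
      qed
    qed
  qed
qed

text \<open>Each axiom involves at most three factors, and finitely many factors lie in a common
  level.\<close>

lemma strict_linear_factor_gt: "strict_linear_on (UNIV :: 'x::linorder factor set) factor_gt"
  unfolding strict_linear_on_def
proof (intro conjI)
  have fin: "strict_linear_on B factor_gt" if "finite B" for B :: "'x factor set"
    using finite_subset_factors_upto[OF that ex_factors_upto]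
      strict_linear_on_factor_gt_upto strict_linear_on_subset by blast
  show "irreflp (factor_gt :: 'x factor \<Rightarrow> _)"
  proof (rule irreflpI)
    fix a :: "'x factor"
    show "\<not> factor_gt a a"
      using strict_linear_on_irrefl[OF fin, of "{a}" a] by simp
  qed
  show "totalp (factor_gt :: 'x factor \<Rightarrow> _)"
  proof (rule totalpI)
    fix a b :: "'x factor"
    assume "a \<noteq> b"
    then show "factor_gt a b \<or> factor_gt b a"
      using strict_linear_on_total[OF fin, of "{a, b}" a b] by simp
  qed
  show "transp (factor_gt :: 'x factor \<Rightarrow> _)"
  proof (rule transpI)
    fix a b d :: "'x factor"
    assume "factor_gt a b" "factor_gt b d"
    then show "factor_gt a d"
      using strict_linear_on_trans[OF fin, of "{a, b, d}" a b d] by simp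
  qed
qed

lemma word_gt_iff: "word_gt u v \<longleftrightarrow> multiset_gt factor_gt u v"
  by (rule word_gt_iff_multiset_gt) (rule strict_linear_on_subset[OF strict_linear_factor_gt], simp)

lemma word_gt_if_size: "size v < size u \<Longrightarrow> word_gt u v"
  by (simp add: word_gt_iff multiset_gt_def)

lemma word_gt_imp_size: "word_gt u v \<Longrightarrow> size v \<le> size u"
  by (auto simp: word_gt_iff multiset_gt_def)

text \<open>Both words have the same size, and no factor greater than \<open>a\<close> is
  \<open>a\<close> or \<open>b\<close>, so the multiplicity of \<open>a\<close> decides.\<close>

lemma word_gt_add_mset:
  assumes "factor_gt a b"
  shows "word_gt (add_mset a r) (add_mset b r)"
proof -
  have "b \<noteq> a"
    using assms strict_linear_on_irrefl[OF strict_linear_factor_gt] by auto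
  moreover have "d \<noteq> a \<and> d \<noteq> b" if "factor_gt d a" for d
    using that assms strict_linear_on_irrefl[OF strict_linear_factor_gt, of a]
      strict_linear_on_asym[OF strict_linear_factor_gt, of a b] by auto
  ultimately show ?thesis
    by (auto simp: word_gt_iff multiset_gt_def intro!: exI[of _ a])
qed

subsection \<open>Words and the linear operator\<close>

lemma CS_mono: "A \<subseteq> B \<Longrightarrow> CS A \<subseteq> CS B"
  by (auto simp: CS_def)

lemma Qn_Suc: "Qn X n \<subseteq> Qn X (Suc n)"
proof (induction n)
  case (Suc n)
  then have "Var ` X \<union> Op ` Qn X n \<subseteq> Var ` X \<union> Op ` Qn X (Suc n)"
    by blast
  then show ?case
    unfolding Qn.simps(2) by (rule CS_mono)
qed (simp add: CS_mono)

lemma Qn_mono: "m \<le> n \<Longrightarrow> Qn X m \<subseteq> Qn X n"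
  by (rule lift_Suc_mono_le[of "Qn X"]) (rule Qn_Suc)

lemma finite_subset_Qn:
  assumes "finite B" "B \<subseteq> Q X"
  shows "\<exists>n. B \<subseteq> Qn X n"
  using assms
proof (induction B)
  case (insert u B)
  then obtain m n where "B \<subseteq> Qn X m" "u \<in> Qn X n"
    by (auto simp: Q_def)
  then have "insert u B \<subseteq> Qn X (max m n)"
    using Qn_mono[of m "max m n" X] Qn_mono[of n "max m n" X] by auto
  then show ?case by blast
qed simp

text \<open>For the inclusion from right to left: a word has finitely many factors, so the arguments
  of its operators lie in one common \<open>Qn X n\<close>.\<close>

lemma Q_eq: "Q X = CS (Var ` X \<union> Op ` Q X)"
proof
  have "Qn X n \<subseteq> CS (Var ` X \<union> Op ` Q X)" for n
  proof (cases n)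
    case 0
    then show ?thesis using CS_mono[of "Var ` X"] by simp
  next
    case (Suc m)
    have "Qn X m \<subseteq> Q X" by (auto simp: Q_def)
    then show ?thesis
      unfolding Suc Qn.simps(2) by (intro CS_mono) blast
  qed
  then show "Q X \<subseteq> CS (Var ` X \<union> Op ` Q X)"
    by (auto simp: Q_def)
next
  show "CS (Var ` X \<union> Op ` Q X) \<subseteq> Q X"
  proof
    fix u assume u: "u \<in> CS (Var ` X \<union> Op ` Q X)"
    let ?B = "{v. Op v \<in># u}"
    have "finite ?B"
      using finite_vimageI[of "set_mset u" Op] by (simp add: vimage_def inj_def)
    moreover have "?B \<subseteq> Q X"
      using u by (auto simp: CS_def)
    ultimately obtain n where "?B \<subseteq> Qn X n"
      using finite_subset_Qn by blast
    have "set_mset u \<subseteq> Var ` X \<union> Op ` Qn X n"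
    proof
      fix a assume "a \<in># u"
      moreover from this u have "a \<in> Var ` X \<union> Op ` Q X"
        by (auto simp: CS_def)
      ultimately show "a \<in> Var ` X \<union> Op ` Qn X n"
        using \<open>?B \<subseteq> Qn X n\<close> by auto
    qed
    then have "u \<in> Qn X (Suc n)"
      using u by (simp add: CS_def)
    then show "u \<in> Q X"
      unfolding Q_def by blast
  qed
qed

lemma Q_iff:
  "u \<in> Q X \<longleftrightarrow> u \<noteq> {#} \<and> (\<forall>x. Var x \<in># u \<longrightarrow> x \<in> X) \<and> (\<forall>v. Op v \<in># u \<longrightarrow> v \<in> Q X)"
proof -
  have "set_mset u \<subseteq> Var ` X \<union> Op ` Q X \<longleftrightarrow>
      (\<forall>x. Var x \<in># u \<longrightarrow> x \<in> X) \<and> (\<forall>v. Op v \<in># u \<longrightarrow> v \<in> Q X)"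
  proof (intro iffI conjI allI impI; (elim conjE)?)
    assume *: "\<forall>x. Var x \<in># u \<longrightarrow> x \<in> X" "\<forall>v. Op v \<in># u \<longrightarrow> v \<in> Q X"
    show "set_mset u \<subseteq> Var ` X \<union> Op ` Q X"
    proof
      fix a assume "a \<in># u"
      then show "a \<in> Var ` X \<union> Op ` Q X"
        using * by (cases a) auto
    qed
  qed auto
  moreover have "u \<in> Q X \<longleftrightarrow> u \<in> CS (Var ` X \<union> Op ` Q X)"
    by (rule arg_cong[OF Q_eq])
  ultimately show ?thesis
    unfolding CS_def by blast
qed

lemma Q_plus: "u \<in> Q X \<Longrightarrow> v \<in> Q X \<Longrightarrow> u + v \<in> Q X"
  using Q_iff[of u X] Q_iff[of v X] Q_iff[of "u + v" X] by auto

lemma Q_Op: "{#Op u#} \<in> Q X \<longleftrightarrow> u \<in> Q X"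
  using Q_iff[of "{#Op u#}" X] by auto

lemma Q_Var: "{#Var x#} \<in> Q X \<longleftrightarrow> x \<in> X"
  using Q_iff[of "{#Var x#}" X] by auto

text \<open>Structural induction on the datatype runs over factors, so membership of a word is
  reduced to words with one factor.\<close>

lemma Q_iff_singletons: "u \<in> Q X \<longleftrightarrow> u \<noteq> {#} \<and> (\<forall>a\<in>#u. {#a#} \<in> Q X)"
proof -
  have "(\<forall>a\<in>#u. {#a#} \<in> Q X) \<longleftrightarrow> (\<forall>x. Var x \<in># u \<longrightarrow> x \<in> X) \<and> (\<forall>v. Op v \<in># u \<longrightarrow> v \<in> Q X)"
  proof
    assume *: "(\<forall>x. Var x \<in># u \<longrightarrow> x \<in> X) \<and> (\<forall>v. Op v \<in># u \<longrightarrow> v \<in> Q X)"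
    show "\<forall>a\<in>#u. {#a#} \<in> Q X"
    proof
      fix a assume "a \<in># u"
      then show "{#a#} \<in> Q X"
        using * by (cases a) (auto simp: Q_Var Q_Op)
    qed
  next
    assume "\<forall>a\<in>#u. {#a#} \<in> Q X"
    then show "(\<forall>x. Var x \<in># u \<longrightarrow> x \<in> X) \<and> (\<forall>v. Op v \<in># u \<longrightarrow> v \<in> Q X)"
      using Q_Var[of _ X] Q_Op[of _ X] by blast
  qed
  then show ?thesis
    using Q_iff[of u X] by blast
qed

lemma sum_mset_in_Q:
  assumes "u \<noteq> {#}" "\<And>a. a \<in># u \<Longrightarrow> h a \<in> Q X"
  shows "sum_mset (image_mset h u) \<in> Q X"
  using assms
proof (induction u)
  case (add a u)
  then show ?case
    by (cases "u = {#}") (auto intro: Q_plus)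
qed simp

text \<open>Monomials at the empty word act as scalars in the monoid algebra, so linearity of
  \<open>scale\<close> reduces to ring laws.\<close>

lemma scale_eq_single_mult: "scale c f = Poly_Mapping.single 0 c * f"
  unfolding scale_def by (rule mult_map_scale_conv_mult)

lemma scale_mon: "scale c (mon u) = Poly_Mapping.single u c"
  by (simp add: scale_eq_single_mult mon_def mult_single)

lemma mon_mult: "mon u * mon v = mon (u + v)"
  by (simp add: mon_def mult_single)

lemma lookup_scale [simp]: "Poly_Mapping.lookup (scale c f) u = c * Poly_Mapping.lookup f u"
  by (simp add: scale_def Poly_Mapping.map.rep_eq when_def)

lemma keys_mon [simp]: "Poly_Mapping.keys (mon u :: 'x word \<Rightarrow>\<^sub>0 'k::comm_ring_1) = {u}"
  by (simp add: mon_def)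

lemma keys_scale: "Poly_Mapping.keys (scale c f) \<subseteq> Poly_Mapping.keys f"
  by (auto simp: in_keys_iff)

lemma poly_mapping_eq_sum:
  assumes "finite A" "Poly_Mapping.keys f \<subseteq> A"
  shows "f = (\<Sum>u\<in>A. scale (Poly_Mapping.lookup f u) (mon u))"
  using assms
  by (intro poly_mapping_eqI)
     (auto simp: lookup_sum scale_mon lookup_single when_def in_keys_iff sum.delta)

text \<open>Linear extension from words. The bound \<open>B\<close> stays fixed, since keys may
  cancel when polynomials are added.\<close>

lemma poly_mapping_span_induct [consumes 1, case_names zero add monomial]:
  fixes f :: "'x word \<Rightarrow>\<^sub>0 'k::comm_ring_1"
  assumes keys: "Poly_Mapping.keys f \<subseteq> B"
    and zero: "R 0"
    and add: "\<And>f g. R f \<Longrightarrow> R g \<Longrightarrow> R (f + g)"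
    and monomial: "\<And>c u. u \<in> B \<Longrightarrow> R (scale c (mon u))"
  shows "R f"
proof -
  have "R (\<Sum>u\<in>A. scale (Poly_Mapping.lookup f u) (mon u))" if "finite A" "A \<subseteq> B" for A
    using that by (induction A) (auto intro: zero add monomial)
  from this[OF finite_keys keys] show ?thesis
    by (simp flip: poly_mapping_eq_sum)
qed

text \<open>The index set may exceed the keys, so that the sums for several polynomials can be taken
  over one set.\<close>

lemma P_eq_sum:
  assumes "finite A" "Poly_Mapping.keys f \<subseteq> A"
  shows "P f = (\<Sum>u\<in>A. Poly_Mapping.single {#Op u#} (Poly_Mapping.lookup f u))"
  unfolding P_def scale_mon using assms
  by (intro sum.mono_neutral_left) (auto simp: in_keys_iff)

lemma P_add: "P (f + g) = P f + P g"
proof -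
  let ?A = "Poly_Mapping.keys f \<union> Poly_Mapping.keys g"
  show ?thesis
    using keys_add[of f g]
    by (simp add: P_eq_sum[of ?A] lookup_add single_add sum.distrib)
qed

lemma P_0 [simp]: "P 0 = 0"
  by (simp add: P_def)

lemma P_minus: "P (- f) = - P f"
  using P_add[of f "- f"] by (simp add: eq_neg_iff_add_eq_0 add.commute)

lemma P_diff: "P (f - g) = P f - P g"
  using P_add[of f "- g"] by (simp add: P_minus)

lemma P_scale: "P (scale c f) = scale c (P f)"
  using keys_scale[of c f]
  by (simp add: P_eq_sum[of "Poly_Mapping.keys f"] scale_eq_single_mult[of c "sum _ _"]
      sum_distrib_left mult_single)

lemma keys_P: "Poly_Mapping.keys (P f) \<subseteq> (\<lambda>u. {#Op u#}) ` Poly_Mapping.keys f"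
proof
  fix w assume "w \<in> Poly_Mapping.keys (P f)"
  then have "(\<Sum>u\<in>Poly_Mapping.keys f.
      Poly_Mapping.lookup (Poly_Mapping.single {#Op u#} (Poly_Mapping.lookup f u)) w) \<noteq> 0"
    by (simp add: P_eq_sum[of "Poly_Mapping.keys f"] in_keys_iff lookup_sum)
  then obtain u where "u \<in> Poly_Mapping.keys f"
    "Poly_Mapping.lookup (Poly_Mapping.single {#Op u#} (Poly_Mapping.lookup f u)) w \<noteq> 0"
    by (meson sum.neutral)
  then show "w \<in> (\<lambda>u. {#Op u#}) ` Poly_Mapping.keys f"
    by (auto simp: lookup_single when_def split: if_splits)
qed

lemma scale_add_right: "scale c (f + g) = scale c f + scale c g"
  by (simp add: scale_eq_single_mult distrib_left)

lemma scale_diff_right: "scale c (f - g) = scale c f - scale c g"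
  by (simp add: scale_eq_single_mult right_diff_distrib)

lemma scale_scale: "scale c (scale d f) = scale (c * d) f"
  by (simp add: scale_eq_single_mult mult_single flip: mult.assoc)

lemma scale_mult_left: "scale c f * g = scale c (f * g)"
  by (simp add: scale_eq_single_mult mult.assoc)

lemma scale_mult_right: "f * scale c g = scale c (f * g)"
  by (simp add: scale_eq_single_mult mult.left_commute)

lemma scale_1: "scale 1 f = f"
  by (simp add: scale_eq_single_mult)

lemma scale_minus_1: "scale (- 1) f = - f"
  by (simp add: scale_eq_single_mult single_uminus)

lemma scale_0_right: "scale c 0 = 0"
  by (simp add: scale_eq_single_mult)

lemmas linear_simps = P_add P_diff P_scale scale_add_right scale_diff_right scale_scale
  scale_mult_left scale_mult_right

lemma KXP_add: "f \<in> KXP X \<Longrightarrow> g \<in> KXP X \<Longrightarrow> f + g \<in> KXP X"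
  using keys_add[of f g] by (auto simp: KXP_def)

lemma KXP_diff: "f \<in> KXP X \<Longrightarrow> g \<in> KXP X \<Longrightarrow> f - g \<in> KXP X"
  using keys_diff[of f g] by (auto simp: KXP_def)

lemma KXP_mult: "f \<in> KXP X \<Longrightarrow> g \<in> KXP X \<Longrightarrow> f * g \<in> KXP X"
  using keys_mult[of f g] by (force simp: KXP_def intro: Q_plus)

lemma KXP_scale: "f \<in> KXP X \<Longrightarrow> scale c f \<in> KXP X"
  using keys_scale[of c f] by (auto simp: KXP_def)

lemma KXP_P: "f \<in> KXP X \<Longrightarrow> P f \<in> KXP X"
  using keys_P[of f] Q_Op[of _ X] by (fastforce simp: KXP_def)

lemma KXP_mon: "mon u \<in> KXP X \<longleftrightarrow> u \<in> Q X"
  by (simp add: KXP_def)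

subsection \<open>Words with one star\<close>

text \<open>Embeds ordinary words into the words over the alphabet with the star; its image consists
  of the words without a star.\<close>

definition lift_word :: "'x word \<Rightarrow> 'x option word" where
  "lift_word u = image_mset (map_factor Some) u"

lemma stars_factor_map_Some [simp]: "stars_factor (map_factor Some a) = 0"
  by (induction a) (auto simp: image_mset.compositionality)

lemma stars_lift_word [simp]: "stars (lift_word u) = 0"
  by (auto simp: stars_def lift_word_def)

lemma subst_word_factor_map_Some [simp]: "subst_word_factor v (map_factor Some a) = {#a#}"
proof (induction a)
  case (Op u)
  then have "image_mset (\<lambda>a. subst_word_factor v (map_factor Some a)) u = image_mset (\<lambda>a. {#a#}) u"
    by (intro image_mset_cong) auto
  then show ?case
    by (simp add: image_mset.compositionality comp_def)
qed simp

lemma subst_word_lift_word [simp]: "subst_word (lift_word u) v = u"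
  by (simp add: subst_word_def lift_word_def image_mset.compositionality comp_def)

lemma subst_factor_map_Some [simp]: "subst_factor s (map_factor Some a) = mon {#a#}"
proof (induction a)
  case (Op u)
  then have "image_mset (\<lambda>a. subst_factor s (map_factor Some a)) u = image_mset (\<lambda>a. mon {#a#}) u"
    by (intro image_mset_cong) auto
  then show ?case
    by (simp add: image_mset.compositionality comp_def prod_mset_mon P_mon)
qed simp

lemma subst_lift_word [simp]: "subst (lift_word u) s = mon u"
  by (simp add: subst_def lift_word_def image_mset.compositionality comp_def prod_mset_mon)

section \<open>Substitution in products and under the operator\<close>

lemma stars_add: "stars (u + v) = stars u + stars v"
  by (simp add: stars_def)

lemma subst_add: "subst (u + v) s = subst u s * subst v s"
  by (simp add: subst_def)

lemma subst_word_add: "subst_word (u + v) w = subst_word u w + subst_word v w"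
  by (simp add: subst_word_def)

lemma stars_Op: "stars {#Op u#} = stars u"
  by (simp add: stars_def)

lemma subst_Op: "subst {#Op u#} s = P (subst u s)"
  by (simp add: subst_def)

lemma subst_word_Op: "subst_word {#Op u#} v = {#Op (subst_word u v)#}"
  by (simp add: subst_word_def)

lemma stars_star: "stars {#Var None#} = 1"
  by (simp add: stars_def)

lemma subst_star: "subst {#Var None#} s = s"
  by (simp add: subst_def)

lemma subst_word_star: "subst_word {#Var None#} v = v"
  by (simp add: subst_word_def)

lemmas star_simps = stars_add subst_add subst_word_add stars_Op subst_Op subst_word_Op
  stars_star subst_star subst_word_star

lemma stars_factor_0: "stars_factor a = 0 \<Longrightarrow> \<exists>b. a = map_factor Some b"
proof (induction a)
  case (Var y)
  then show ?case by (cases y) (auto intro!: exI[of _ "Var _"])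
next
  case (Op u)
  then have "\<forall>a\<in>#u. \<exists>b. a = map_factor Some b"
    by (auto simp: sum_mset_0_iff)
  then obtain h where "\<forall>a\<in>#u. a = map_factor Some (h a)"
    by metis
  then have "u = image_mset (map_factor Some) (image_mset h u)"
    by (auto simp: image_mset.compositionality comp_def cong: image_mset_cong)
  then show ?case
    by (intro exI[of _ "Op (image_mset h u)"]) simp
qed

lemma stars_0:
  assumes "stars u = 0"
  shows "\<exists>r. u = lift_word r"
proof -
  have "\<forall>a\<in>#u. \<exists>b. a = map_factor Some b"
    using assms by (auto simp: stars_def intro!: stars_factor_0)
  then obtain h where "\<forall>a\<in>#u. a = map_factor Some (h a)"
    by metis
  then have "u = lift_word (image_mset h u)"
    by (auto simp: lift_word_def image_mset.compositionality comp_def cong: image_mset_cong)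
  then show ?thesis ..
qed

text \<open>The star count is a sum of natural numbers over the factors. If it is 1, one factor
  contributes 1 and the others contribute 0, hence form a lifted word.\<close>

lemma stars_1_cases:
  assumes "stars u = 1"
  obtains (star) r where "u = {#Var None#} + lift_word r"
  | (nested) q r where "u = {#Op q#} + lift_word r" "stars q = 1"
proof -
  have "\<exists>a. a \<in># u \<and> stars_factor a \<noteq> 0"
  proof (rule ccontr)
    assume "\<nexists>a. a \<in># u \<and> stars_factor a \<noteq> 0"
    then have "stars u = 0"
      by (auto simp: stars_def)
    with assms show False by simp
  qed
  then obtain a u' where u: "u = {#a#} + u'" "stars_factor a \<noteq> 0"
    by (metis multi_member_split add_mset_add_single add.commute)
  then have "stars_factor a + stars u' = 1"
    using assms by (simp add: stars_def)
  then have "stars_factor a = 1" "stars u' = 0"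
    using u(2) by linarith+
  moreover obtain r where "u' = lift_word r"
    using stars_0 \<open>stars u' = 0\<close> by blast
  ultimately have a: "stars_factor a = 1" "u = {#a#} + lift_word r"
    using u by simp_all
  show ?thesis
  proof (cases a)
    case (Var y)
    then show ?thesis
      using a star[of r] by (cases y) simp_all
  next
    case (Op q)
    then show ?thesis
      using a nested[of q r] by (simp add: stars_def)
  qed
qed

text \<open>The induction follows the path from the outermost product down to the star.\<close>

lemma stars_1_induct [consumes 1, case_names star nested]:
  assumes "stars u = 1"
    and star: "\<And>r. R ({#Var None#} + lift_word r)"
    and nested: "\<And>q r. stars q = 1 \<Longrightarrow> R q \<Longrightarrow> R ({#Op q#} + lift_word r)"
  shows "R u"
proof -
  \<comment> \<open>The datatype induction works on factors, so the claim concerns the factor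
    carrying the star, next to an arbitrary lifted word.\<close>
  have "stars_factor a = 1 \<Longrightarrow> R ({#a#} + lift_word r)" for a r
  proof (induction a arbitrary: r)
    case (Var y)
    then show ?case using star by (auto split: if_splits)
  next
    case (Op q)
    then have q: "stars q = 1"
      by (simp add: stars_def)
    then have "R q"
    proof (cases rule: stars_1_cases)
      case (star r)
      then show ?thesis using assms(2)[of r] by simp
    next
      case (nested q' r')
      then show ?thesis
        using Op.IH[of "Op q'" r'] by (simp add: stars_def)
    qed
    with q show ?case by (rule assms(3))
  qed
  with \<open>stars u = 1\<close> show ?thesis
    by (cases rule: stars_1_cases) (auto simp: stars_def)
qed

lemma lift_word_in_Q:
  assumes "u \<in> Q X"
  shows "lift_word u \<in> Q (insert None (Some ` X))"
proof -
  let ?Y = "insert None (Some ` X)"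
  \<comment> \<open>The passage from factors to words is used twice: for the argument of
    \<open>Op\<close> inside the induction and for the given word.\<close>
  have word: "lift_word u \<in> Q ?Y"
    if "u \<in> Q X" "\<And>a. a \<in># u \<Longrightarrow> {#a#} \<in> Q X \<Longrightarrow> {#map_factor Some a#} \<in> Q ?Y" for u
    using that Q_iff_singletons[of u X] Q_iff_singletons[of "lift_word u" ?Y]
    by (auto simp: lift_word_def)
  have "{#a#} \<in> Q X \<Longrightarrow> {#map_factor Some a#} \<in> Q ?Y" for a
  proof (induction a)
    case (Op u)
    then show ?case
      using word[of u] by (simp add: Q_Op lift_word_def)
  qed (auto simp: Q_Var)
  with assms show ?thesis
    using word by blast
qed

lemma subst_word_in_Q:
  assumes "q \<in> Q (insert None (Some ` X))" "v \<in> Q X"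
  shows "subst_word q v \<in> Q X"
proof -
  let ?Y = "insert None (Some ` X)"
  have word: "subst_word q v \<in> Q X"
    if "q \<in> Q ?Y" "\<And>a. a \<in># q \<Longrightarrow> {#a#} \<in> Q ?Y \<Longrightarrow> subst_word_factor v a \<in> Q X" for q
    using that Q_iff_singletons[of q ?Y] unfolding subst_word_def
    by (intro sum_mset_in_Q) auto
  have "{#a#} \<in> Q ?Y \<Longrightarrow> subst_word_factor v a \<in> Q X" for a
  proof (induction a)
    case (Var y)
    then show ?case
      using assms(2) by (auto simp: Q_Var split: option.split)
  next
    case (Op u)
    then show ?case
      using word[of u] by (simp add: Q_Op subst_word_def)
  qed
  with assms(1) show ?thesis
    using word by blast
qed

lemma Qstar_star: "{#Var None#} \<in> Qstar X"
  by (simp add: Qstar_def Q_Var stars_star)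

lemma Qstar_Op: "q \<in> Qstar X \<Longrightarrow> {#Op q#} \<in> Qstar X"
  by (simp add: Qstar_def Q_Op stars_Op)

lemma Qstar_add_lift_word: "q \<in> Qstar X \<Longrightarrow> v \<in> Q X \<Longrightarrow> q + lift_word v \<in> Qstar X"
  by (simp add: Qstar_def stars_add Q_plus lift_word_in_Q)

text \<open>As the star occurs once, substitution composes multiplications by fixed words with
  applications of \<open>P\<close>, all of which are additive.\<close>

lemma subst_add_right: "stars q = 1 \<Longrightarrow> subst q (f + g) = subst q f + subst q g"
  by (induction rule: stars_1_induct) (simp_all only: star_simps subst_lift_word distrib_right P_add)

lemma subst_scale_right: "stars q = 1 \<Longrightarrow> subst q (scale c f) = scale c (subst q f)"
  by (induction rule: stars_1_induct) (simp_all only: star_simps subst_lift_word scale_mult_left P_scale)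

lemma subst_0_right: "stars q = 1 \<Longrightarrow> subst q 0 = 0"
  by (induction rule: stars_1_induct) (simp_all only: star_simps subst_lift_word mult_zero_left P_0)

lemma subst_diff_right: "stars q = 1 \<Longrightarrow> subst q (f - g) = subst q f - subst q g"
  using subst_add_right[of q "f - g" g] by simp

lemma keys_subst:
  fixes f :: "'x word \<Rightarrow>\<^sub>0 'k::comm_ring_1"
  assumes "stars q = 1"
  shows "Poly_Mapping.keys (subst q f) \<subseteq> subst_word q ` Poly_Mapping.keys f"
proof -
  have "Poly_Mapping.keys (subst q g) \<subseteq> subst_word q ` B" if "Poly_Mapping.keys g \<subseteq> B"
    for g :: "'x word \<Rightarrow>\<^sub>0 'k" and B
    using that
  proof (induction rule: poly_mapping_span_induct)
    case (add g h)
    then show ?case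
      using keys_add[of "subst q g" "subst q h"] by (auto simp: subst_add_right[OF assms])
  next
    case (monomial d u)
    then show ?case
      using keys_scale[of d "mon (subst_word q u)"]
      by (auto simp: subst_scale_right[OF assms] subst_mon)
  qed (simp add: subst_0_right[OF assms])
  then show ?thesis by blast
qed

text \<open>Monotonicity in the form that fits a relation, whose leading word has breadth 2 and
  whose other words have breadth 1. Breadth decides at the level of the star, and each enclosing
  operator passes the comparison outwards through \<open>word_gt_add_mset\<close>.\<close>

lemma word_gt_subst_word:
  assumes "stars q = 1" "size l < size k"
  shows "word_gt (subst_word q k) (subst_word q l)"
  using assms(1)
proof (induction rule: stars_1_induct)
  case (star r)
  show ?case
    using assms(2) by (intro word_gt_if_size)
       (simp only: subst_word_add subst_word_star subst_word_lift_word size_union add_less_cancel_right)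
next
  case (nested q r)
  then have "word_gt (add_mset (Op (subst_word q k)) r) (add_mset (Op (subst_word q l)) r)"
    by (intro word_gt_add_mset factor_gt_word_gt.Op_Op)
  then show ?case
    by (simp only: subst_word_add subst_word_Op subst_word_lift_word add_mset_add_single[of _ r] add.commute)
qed

subsection \<open>Trivial elements\<close>

lemma trivial_mod_0: "trivial_mod X S w 0"
  unfolding trivial_mod_def by (rule exI[of _ 0]) simp

text \<open>The function updates place the new summand at index \<open>n\<close>; closure under sums
  follows by repetition.\<close>

lemma trivial_mod_add_scale_subst:
  assumes "trivial_mod X S w h" "u \<in> Qstar X" "s \<in> S" "word_gt w (subst_word u (lead s))"
  shows "trivial_mod X S w (h + scale d (subst u s))"
proof -
  from assms(1) obtain n :: nat and \<alpha> v t where h: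
    "\<forall>i<n. v i \<in> Qstar X \<and> t i \<in> S \<and> word_gt w (subst_word (v i) (lead (t i)))"
    "h = (\<Sum>i<n. scale (\<alpha> i) (subst (v i) (t i)))"
    unfolding trivial_mod_def by blast
  show ?thesis
    unfolding trivial_mod_def
    using h assms(2-4)
    by (intro exI[of _ "Suc n"] exI[of _ "\<alpha>(n := d)"] exI[of _ "v(n := u)"] exI[of _ "t(n := s)"])
       (auto simp: less_Suc_eq)
qed

lemma trivial_mod_subst:
  "u \<in> Qstar X \<Longrightarrow> s \<in> S \<Longrightarrow> word_gt w (subst_word u (lead s)) \<Longrightarrow> trivial_mod X S w (subst u s)"
  using trivial_mod_add_scale_subst[OF trivial_mod_0, of u X s S w 1] by (simp add: scale_1)

lemma trivial_mod_add:
  assumes "trivial_mod X S w g" "trivial_mod X S w h"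
  shows "trivial_mod X S w (g + h)"
proof -
  from assms(2) obtain n :: nat and \<alpha> u s where h:
    "\<forall>i<n. u i \<in> Qstar X \<and> s i \<in> S \<and> word_gt w (subst_word (u i) (lead (s i)))"
    "h = (\<Sum>i<n. scale (\<alpha> i) (subst (u i) (s i)))"
    unfolding trivial_mod_def by blast
  have "trivial_mod X S w (g + (\<Sum>i<m. scale (\<alpha> i) (subst (u i) (s i))))" if "m \<le> n" for m
    using that
  proof (induction m)
    case (Suc m)
    then show ?case
      using trivial_mod_add_scale_subst[of X S w _ "u m" "s m" "\<alpha> m"] h(1)
      by (simp add: add.assoc[symmetric])
  qed (simp add: assms(1))
  then show ?thesis
    using h(2) by blast
qed

lemma trivial_mod_scale:
  assumes "trivial_mod X S w h"
  shows "trivial_mod X S w (scale d h)"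
proof -
  from assms obtain n :: nat and \<alpha> u s where h:
    "\<forall>i<n. u i \<in> Qstar X \<and> s i \<in> S \<and> word_gt w (subst_word (u i) (lead (s i)))"
    "h = (\<Sum>i<n. scale (\<alpha> i) (subst (u i) (s i)))"
    unfolding trivial_mod_def by blast
  have "scale d h = (\<Sum>i<n. scale (d * \<alpha> i) (subst (u i) (s i)))"
    unfolding h(2) scale_scale[symmetric] by (simp add: scale_eq_single_mult[of d] sum_distrib_left)
  then show ?thesis
    unfolding trivial_mod_def
    by (intro exI[of _ n] exI[of _ "\<lambda>i. d * \<alpha> i"] exI[of _ u] exI[of _ s] conjI h(1))
qed

lemma trivial_mod_diff:
  "trivial_mod X S w g \<Longrightarrow> trivial_mod X S w h \<Longrightarrow> trivial_mod X S w (g - h)"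
  using trivial_mod_add[of X S w g "scale (- 1) h"] trivial_mod_scale[of X S w h "- 1"]
  by (simp add: scale_minus_1)

text \<open>Breadth is compared first in the order, so \<open>w\<close> exceeds every word of
  \<open>r\<close> and cannot cancel.\<close>

lemma
  fixes r :: "'x::linorder word \<Rightarrow>\<^sub>0 'k::comm_ring_1"
  assumes "\<And>l. l \<in> Poly_Mapping.keys r \<Longrightarrow> size l < size w"
  shows lead_mon_diff: "lead (mon w - r) = w"
    and monic_mon_diff: "monic (mon w - r)"
proof -
  have "w \<notin> Poly_Mapping.keys r"
    using assms by blast
  then have lookup: "Poly_Mapping.lookup (mon w - r) w = 1"
    by (simp add: lookup_minus mon_def in_keys_iff)
  have keys: "v = w \<or> size v < size w" if "v \<in> Poly_Mapping.keys (mon w - r)" for v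
    using that keys_diff[of "mon w" r] assms by auto
  show lead: "lead (mon w - r) = w"
    unfolding lead_def
  proof (rule the_equality)
    show "w \<in> Poly_Mapping.keys (mon w - r) \<and>
        (\<forall>v\<in>Poly_Mapping.keys (mon w - r). v \<noteq> w \<longrightarrow> word_gt w v)"
      using lookup keys by (auto simp: in_keys_iff intro: word_gt_if_size)
  next
    fix u
    assume u: "u \<in> Poly_Mapping.keys (mon w - r) \<and>
        (\<forall>v\<in>Poly_Mapping.keys (mon w - r). v \<noteq> u \<longrightarrow> word_gt u v)"
    have "w \<in> Poly_Mapping.keys (mon w - r)"
      using lookup by (simp add: in_keys_iff)
    then show "u = w"
      using u keys[of u] word_gt_imp_size[of u w] by auto
  qed
  show "monic (mon w - r)"
    using lookup lead by (auto simp: monic_def)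
qed

subsection \<open>The Rota-Baxter relations\<close>

text \<open>The operation \<open>A\<close> from above. For a Rota-Baxter operator \<open>P\<close>
  of weight \<open>c\<close> it is the derived product, which \<open>P\<close> sends to the original
  product.\<close>

definition rb_op :: "'k::comm_ring_1 \<Rightarrow> ('x word \<Rightarrow>\<^sub>0 'k) \<Rightarrow> ('x word \<Rightarrow>\<^sub>0 'k) \<Rightarrow> ('x word \<Rightarrow>\<^sub>0 'k)" where
  "rb_op c f g = P f * g + f * P g + scale c (f * g)"

text \<open>The expression \<open>F\<close> from above: the failure of \<open>P\<close> to turn
  \<open>rb_op c\<close> into multiplication.\<close>

definition rb_rel :: "'k::comm_ring_1 \<Rightarrow> ('x word \<Rightarrow>\<^sub>0 'k) \<Rightarrow> ('x word \<Rightarrow>\<^sub>0 'k) \<Rightarrow> ('x word \<Rightarrow>\<^sub>0 'k)" where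
  "rb_rel c f g = P f * P g - P (rb_op c f g)"

lemma rota_baxter_relations_eq:
  "rota_baxter_relations X c = {rb_rel c (mon u) (mon v) | u v. u \<in> Q X \<and> v \<in> Q X}"
  by (simp add: rota_baxter_relations_def rb_rel_def rb_op_def linear_simps algebra_simps)

lemma rb_op_KXP: "f \<in> KXP X \<Longrightarrow> g \<in> KXP X \<Longrightarrow> rb_op c f g \<in> KXP X"
  unfolding rb_op_def by (intro KXP_add KXP_mult KXP_P KXP_scale)

lemma rb_rel_KXP: "f \<in> KXP X \<Longrightarrow> g \<in> KXP X \<Longrightarrow> rb_rel c f g \<in> KXP X"
  unfolding rb_rel_def by (intro KXP_diff KXP_mult KXP_P rb_op_KXP)

lemma rb_rel_commute: "rb_rel c f g = rb_rel c g f"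
  by (simp add: rb_rel_def rb_op_def algebra_simps)

lemma rb_rel_add_left: "rb_rel c (f + f') g = rb_rel c f g + rb_rel c f' g"
  by (simp add: rb_rel_def rb_op_def linear_simps algebra_simps)

lemma rb_rel_scale_left: "rb_rel c (scale d f) g = scale d (rb_rel c f g)"
  by (simp add: rb_rel_def rb_op_def linear_simps algebra_simps)

lemma rb_rel_0_left: "rb_rel c 0 g = 0"
  by (simp add: rb_rel_def rb_op_def scale_0_right)

text \<open>Separates the word of breadth 2 from an element in the image of \<open>P\<close>, whose
  words all have breadth 1.\<close>

lemma rb_rel_mon: "rb_rel c (mon u) (mon v) = mon {#Op u, Op v#} - P (rb_op c (mon u) (mon v))"
  by (simp add: rb_rel_def P_mon mon_mult add_mset_commute)

lemma size_keys_P: "l \<in> Poly_Mapping.keys (P f) \<Longrightarrow> size l = 1"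
  using keys_P[of f] by auto

lemma lead_rb_rel: "lead (rb_rel c (mon u) (mon v)) = {#Op u, Op v#}"
  unfolding rb_rel_mon by (rule lead_mon_diff) (auto dest: size_keys_P)

lemma monic_rb_rel: "monic (rb_rel c (mon u) (mon v))"
  unfolding rb_rel_mon by (rule monic_mon_diff) (auto dest: size_keys_P)

text \<open>On words, the relation itself with the bare star as context is the required summand;
  bilinearity extends this to \<open>f\<close> and \<open>g\<close>.\<close>

lemma trivial_mod_rb_rel:
  fixes c :: "'k::comm_ring_1" and X :: "'x::linorder set"
  assumes "Poly_Mapping.keys f \<subseteq> A" "Poly_Mapping.keys g \<subseteq> B"
    and gt: "\<And>u v. u \<in> A \<Longrightarrow> v \<in> B \<Longrightarrow> u \<in> Q X \<and> v \<in> Q X \<and> word_gt w {#Op u, Op v#}"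
  shows "trivial_mod X (rota_baxter_relations X c) w (rb_rel c f g)"
proof -
  let ?T = "trivial_mod X (rota_baxter_relations X c) w"
  have words: "?T (rb_rel c (mon u) (mon v))" if "u \<in> A" "v \<in> B" for u v
    using trivial_mod_subst[OF Qstar_star, of "rb_rel c (mon u) (mon v)" "rota_baxter_relations X c" w]
      gt[OF that] by (auto simp: rota_baxter_relations_eq subst_star subst_word_star lead_rb_rel)
  \<comment> \<open>Symmetry brings \<open>f\<close> to the left, so that linearity in the first
    argument serves for both arguments.\<close>
  have "?T (rb_rel c (mon v) f)" if "v \<in> B" for v
    using assms(1)
  proof (induction rule: poly_mapping_span_induct)
    case (monomial d u)
    then show ?case
      using words[of u v] that
      by (simp add: rb_rel_commute[of c "mon v"] rb_rel_scale_left trivial_mod_scale)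
  qed (simp_all add: rb_rel_commute[of c "mon v"] rb_rel_0_left rb_rel_add_left
      trivial_mod_0 trivial_mod_add)
  with assms(2) have "?T (rb_rel c g f)"
    by (induction rule: poly_mapping_span_induct)
       (simp_all add: rb_rel_add_left rb_rel_0_left rb_rel_scale_left
        trivial_mod_0 trivial_mod_scale trivial_mod_add)
  then show ?thesis
    by (simp add: rb_rel_commute)
qed

text \<open>The terms \<open>P f * P g * P h\<close> cancel. What remains under \<open>P\<close>
  rests on \<open>rb_op c f (rb_op c g h) - rb_op c h (rb_op c f g) = h * rb_rel c f g - f * rb_rel
  c g h\<close>, the associativity of \<open>rb_op\<close> up to relations.\<close>

lemma rb_rel_overlap:
  "P h * rb_rel c f g - P f * rb_rel c g h =
     rb_rel c f (rb_op c g h) - rb_rel c h (rb_op c f g) + (P (h * rb_rel c f g) - P (f * rb_rel c g h))"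
  by (simp add: rb_rel_def rb_op_def linear_simps algebra_simps)

text \<open>By definition \<open>P h * P g\<close> equals
  \<open>rb_rel c h g + P (rb_op c h g)\<close>, and \<open>rb_rel\<close> is additive in its first
  argument.\<close>

lemma rb_rel_nested:
  "rb_rel c f g - P h * P g = rb_rel c (f - h) g - P (rb_op c h g)"
  by (simp add: rb_rel_def rb_op_def linear_simps algebra_simps)

text \<open>The four terms of \<open>rb_rel_overlap\<close> are trivial for reasons of breadth:
  their leading words have breadth 1 or 2, against breadth 3 of \<open>w\<close>.\<close>

lemma trivial_mod_intersection:
  fixes c :: "'k::comm_ring_1" and X :: "'x::linorder set"
  assumes Q: "x \<in> Q X" "y \<in> Q X" "z \<in> Q X" and w: "size w = 3"
  shows "trivial_mod X (rota_baxter_relations X c) w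
    (mon {#Op z#} * rb_rel c (mon x) (mon y) - mon {#Op x#} * rb_rel c (mon y) (mon z))"
proof -
  let ?S = "rota_baxter_relations X c"
  have context_trivial: "trivial_mod X ?S w (P (mon p * rb_rel c (mon u) (mon v)))"
    if "p \<in> Q X" "u \<in> Q X" "v \<in> Q X" for p u v
  proof -
    let ?q = "{#Op ({#Var None#} + lift_word p)#}"
    have "?q \<in> Qstar X"
      by (intro Qstar_Op Qstar_add_lift_word Qstar_star that)
    moreover have "rb_rel c (mon u) (mon v) \<in> ?S"
      using that by (auto simp: rota_baxter_relations_eq)
    moreover have "word_gt w (subst_word ?q (lead (rb_rel c (mon u) (mon v))))"
      using w by (intro word_gt_if_size) (simp only: subst_word_Op size_single)
    ultimately have "trivial_mod X ?S w (subst ?q (rb_rel c (mon u) (mon v)))"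
      by (rule trivial_mod_subst)
    then show ?thesis
      by (simp only: star_simps subst_lift_word mult.commute)
  qed
  \<comment> \<open>Bounding the keys of \<open>rb_op\<close> by all of \<open>Q X\<close> suffices,
    since every relation has a leading word of breadth 2.\<close>
  have rel_trivial: "trivial_mod X ?S w (rb_rel c (mon p) (rb_op c (mon u) (mon v)))"
    if "p \<in> Q X" "u \<in> Q X" "v \<in> Q X" for p u v
  proof (rule trivial_mod_rb_rel[where A = "{p}" and B = "Q X"])
    show "Poly_Mapping.keys (rb_op c (mon u) (mon v)) \<subseteq> Q X"
      using rb_op_KXP[of "mon u" X "mon v" c] that by (simp add: KXP_def)
  qed (use that w in \<open>auto intro: word_gt_if_size\<close>)
  show ?thesis
    unfolding P_mon[symmetric] rb_rel_overlap
    by (intro trivial_mod_add trivial_mod_diff rel_trivial context_trivial Q)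
qed

lemma trivial_mod_inclusion:
  fixes c :: "'k::comm_ring_1" and X :: "'x::linorder set"
  assumes Q: "x \<in> Q X" "y \<in> Q X" "v \<in> Q X" and q: "q \<in> Qstar X"
    and b: "b = subst_word q {#Op x, Op y#}"
  shows "trivial_mod X (rota_baxter_relations X c) {#Op b, Op v#}
    (rb_rel c (mon b) (mon v) - P (subst q (rb_rel c (mon x) (mon y))) * P (mon v))"
proof -
  let ?S = "rota_baxter_relations X c" and ?w = "{#Op b, Op v#}"
  let ?g = "rb_rel c (mon x) (mon y)"
  have stars: "stars q = 1" and q_Q: "q \<in> Q (insert None (Some ` X))"
    using q by (simp_all add: Qstar_def)
  have g: "?g \<in> ?S"
    using Q by (auto simp: rota_baxter_relations_eq)
  \<comment> \<open>One operator around a star word gives breadth 1, below the breadth 2 of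
    \<open>?w\<close>.\<close>
  have Op_trivial: "trivial_mod X ?S ?w (P (subst p ?g))" if "p \<in> Qstar X" for p
  proof -
    have "trivial_mod X ?S ?w (subst {#Op p#} ?g)"
      using that g by (intro trivial_mod_subst Qstar_Op word_gt_if_size) (simp_all add: subst_word_Op)
    then show ?thesis by (simp only: subst_Op)
  qed
  \<comment> \<open>The terms of \<open>rb_op\<close> become three contexts for the same relation:
    \<open>Op q\<close> beside \<open>v\<close>, \<open>q\<close> beside \<open>Op v\<close>, and
    \<open>q\<close> beside \<open>v\<close>.\<close>
  have "P (rb_op c (subst q ?g) (mon v)) = P (subst ({#Op q#} + lift_word v) ?g)
      + P (subst (q + lift_word {#Op v#}) ?g) + scale c (P (subst (q + lift_word v) ?g))"
    by (simp only: rb_op_def star_simps subst_lift_word linear_simps P_mon)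
  moreover have "trivial_mod X ?S ?w \<dots>"
    by (intro trivial_mod_add trivial_mod_scale Op_trivial Qstar_add_lift_word Qstar_Op q)
       (simp_all add: Q Q_Op)
  ultimately have op: "trivial_mod X ?S ?w (P (rb_op c (subst q ?g) (mon v)))"
    by simp
  \<comment> \<open>The leading word of the relation reproduces \<open>b\<close>, so only its part
    in the image of \<open>P\<close> survives in the difference.\<close>
  define t where "t = subst q (P (rb_op c (mon x) (mon y)))"
  have "mon b - subst q ?g = t"
    by (simp add: rb_rel_mon subst_diff_right[OF stars] subst_mon b t_def)
  moreover have "trivial_mod X ?S ?w (rb_rel c t (mon v))"
  proof (rule trivial_mod_rb_rel[where B = "{v}"])
    let ?K = "Poly_Mapping.keys (P (rb_op c (mon x) (mon y)))"
    show "Poly_Mapping.keys t \<subseteq> subst_word q ` ?K"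
      unfolding t_def by (rule keys_subst[OF stars])
    have K: "?K \<subseteq> Q X"
      using KXP_P[OF rb_op_KXP[of "mon x" X "mon y" c]] Q by (simp add: KXP_def)
    fix u v' assume "u \<in> subst_word q ` ?K" "v' \<in> {v}"
    then obtain l where l: "u = subst_word q l" "l \<in> ?K" "v' = v"
      by blast
    \<comment> \<open>Here a word of breadth 1 replaces the leading word of breadth 2 at the
      star.\<close>
    have "word_gt b u"
      unfolding b l(1) using size_keys_P[OF l(2)] by (intro word_gt_subst_word[OF stars]) simp
    then show "u \<in> Q X \<and> v' \<in> Q X \<and> word_gt ?w {#Op u, Op v'#}"
      using l K Q subst_word_in_Q[OF q_Q, of l]
      by (auto intro!: word_gt_add_mset factor_gt_word_gt.Op_Op)
  qed simp
  ultimately show ?thesis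
    unfolding rb_rel_nested by (intro trivial_mod_diff op) simp
qed

section \<open>Overlaps of two leading words\<close>

lemma pair_mset_eq_iff: "{#a, b#} = {#a', b'#} \<longleftrightarrow> a = a' \<and> b = b' \<or> a = b' \<and> b = a'"
  by (auto simp: add_eq_conv_ex)

text \<open>If \<open>p = p'\<close>, cancellation would make the pairs equal. Hence
  \<open>p'\<close> lies in the first pair and \<open>p\<close> in the second, and the remaining
  factor \<open>k\<close> is common to both.\<close>

lemma triple_mset_eqE:
  assumes "add_mset p {#a, b#} = add_mset p' {#a', b'#}" "{#a, b#} \<noteq> {#a', b'#}"
  obtains k where "{#a, b#} = {#p', k#}" "{#a', b'#} = {#k, p#}"
proof -
  from assms obtain K where K: "{#a, b#} = add_mset p' K" "{#a', b'#} = add_mset p K"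
    by (auto simp: add_eq_conv_ex[of p _ p'])
  from K(1) have "size K = 1"
    by (metis size_add_mset size_single add_left_cancel plus_1_eq_Suc)
  then obtain k where "K = {#k#}"
    using size_1_singleton_mset by blast
  then show ?thesis
    using that[of k] K by (simp add: add_mset_commute)
qed

theorem theorem4p1:
  fixes X :: "'x::wellorder set" and c :: "'k::comm_ring_1"
  shows "groebner_shirshov_basis X (rota_baxter_relations X c)"
  unfolding groebner_shirshov_basis_def
proof (intro conjI ballI allI impI)
  let ?S = "rota_baxter_relations X c"
  show "?S \<subseteq> KXP X"
    by (auto simp: rota_baxter_relations_eq KXP_mon intro: rb_rel_KXP)
  show "monic f" if "f \<in> ?S" for f
    using that by (auto simp: rota_baxter_relations_eq monic_rb_rel)
  fix f g w h
  assume "f \<in> ?S" "g \<in> ?S" and comp: "composition X f g w h"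
  then obtain u v u' v' where
    Q: "u \<in> Q X" "v \<in> Q X" "u' \<in> Q X" "v' \<in> Q X" and
    f: "f = rb_rel c (mon u) (mon v)" and g: "g = rb_rel c (mon u') (mon v')"
    by (auto simp: rota_baxter_relations_eq)
  have lead: "lead f = {#Op u, Op v#}" "lead g = {#Op u', Op v'#}"
    by (simp_all add: f g lead_rb_rel)
  \<comment> \<open>The leading word determines the unordered pair of arguments, and
    \<open>rb_rel\<close> is symmetric.\<close>
  have same: "f = g" if "lead f = lead g"
    using that[unfolded lead] unfolding f g
    by (auto simp: pair_mset_eq_iff rb_rel_commute)
  show "trivial_mod X ?S w h"
    using comp
  proof cases
    case (intersection a b)
    \<comment> \<open>Nonemptiness of \<open>a\<close> bounds the breadth of \<open>w\<close> below
      by 3, and the overlap condition bounds it above by 3.\<close>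
    have "size w = size a + 2" "size w = size b + 2" "size w < 4"
      using arg_cong[OF intersection(4), of size] arg_cong[OF intersection(5), of size] intersection(6)
      by (simp_all add: lead)
    moreover have "a \<noteq> {#}"
      using intersection(2) Q_iff by blast
    ultimately have sz: "size a = 1" "size b = 1" "size w = 3"
      by (simp_all add: nonempty_has_size)
    then obtain p p' where p: "a = {#p#}" "b = {#p'#}"
      using size_1_singleton_mset by metis
    have eq: "add_mset p {#Op u, Op v#} = add_mset p' {#Op u', Op v'#}"
      using intersection(4,5) by (simp add: lead p add_mset_commute)
    show ?thesis
    proof (cases "lead f = lead g")
      case True
      \<comment> \<open>Cancellation also gives \<open>a = b\<close>, so the composition is
        zero.\<close>
      then show ?thesis
        using intersection same by (auto simp: trivial_mod_0)
    next
      case False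
      then obtain k where k: "{#Op u, Op v#} = {#p', k#}" "{#Op u', Op v'#} = {#k, p#}"
        using triple_mset_eqE[OF eq] by (metis lead)
      \<comment> \<open>The factor shared by the leading words is \<open>Op y\<close>, and
        \<open>w\<close> is the product of \<open>Op x\<close>, \<open>Op y\<close> and
        \<open>Op z\<close>.\<close>
      then obtain x y z where xyz: "p = Op z" "p' = Op x" "k = Op y"
        by (auto simp: pair_mset_eq_iff)
      have "f = rb_rel c (mon x) (mon y)" "g = rb_rel c (mon y) (mon z)"
        using k unfolding xyz by (auto simp: pair_mset_eq_iff f g rb_rel_commute)
      moreover have "x \<in> Q X" "y \<in> Q X" "z \<in> Q X"
        using k Q unfolding xyz by (auto simp: pair_mset_eq_iff)
      ultimately show ?thesis
        using trivial_mod_intersection[of x X y z w c] sz(3)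
        by (simp add: intersection(1) p xyz)
    qed
  next
    case (inclusion q)
    have stars: "stars q = 1" and q_Q: "q \<in> Q (insert None (Some ` X))"
      using inclusion by (simp_all add: Qstar_def)
    have w: "subst_word q (lead g) = {#Op u, Op v#}"
      using inclusion lead by simp
    from stars show ?thesis
    proof (cases rule: stars_1_cases)
      \<comment> \<open>A star at the top level leaves no room for further factors, so the leading
        words agree and the composition vanishes.\<close>
      case (star r)
      then have "lead g + r = lead f"
        using w by (simp only: subst_word_add subst_word_star subst_word_lift_word lead)
      moreover from this have "size (lead g + r) = size (lead f)"
        by (rule arg_cong)
      then have "r = {#}"
        by (simp add: lead)
      ultimately show ?thesis
        using inclusion(1) same star
        by (simp add: subst_star lift_word_def trivial_mod_0)
    next
      case (nested q' r)
      have q': "q' \<in> Qstar X"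
        using Q_iff[of q "insert None (Some ` X)"] q_Q nested by (auto simp: Qstar_def)
      \<comment> \<open>\<open>b\<close> is the argument of the factor that contains the star;
        \<open>d\<close> below is the argument of the other factor.\<close>
      define b where "b = subst_word q' {#Op u', Op v'#}"
      have "add_mset (Op b) r = {#Op u, Op v#}"
        using w
        by (simp only: nested subst_word_add subst_word_Op subst_word_lift_word b_def lead
            add_mset_add_single[of _ r] add.commute)
      then obtain d where d: "r = {#Op d#}" "b = u \<and> d = v \<or> b = v \<and> d = u"
        by (auto simp: add_eq_conv_ex)
      then have "f = rb_rel c (mon b) (mon d)" "w = {#Op b, Op d#}" "d \<in> Q X"
        using inclusion Q by (auto simp: f lead_rb_rel rb_rel_commute add_mset_commute)
      moreover have "subst q g = P (subst q' g) * P (mon d)"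
        by (simp only: nested d star_simps subst_lift_word P_mon)
      ultimately show ?thesis
        using trivial_mod_inclusion[OF Q(3,4) \<open>d \<in> Q X\<close> q' b_def] inclusion(1)
        by (simp add: g)
    qed
  qed
qed

end
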